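(* For any $p\in[1,\infty]$, the spectral radius of the backward Collatz-Koopman operator $B_{T,p}\colon\ell_p\to\ell_p$ satisfies $$1\le\rho(B_{T,p})\le\varphi^{\frac1p},$$ where $\varphi=\frac{1+\sqrt5}{2}$. In particular $\rho(B_{T,\infty})=1$.
   Context: $\mathbb{N}^*=\{1,2,3,\dots\}$. The Collatz map $T\colon\mathbb{N}^*\to\mathbb{N}^*$ is $T(n)=n/2$ for $n$ even and $T(n)=(3n+1)/2$ for $n$ odd. $\ell_p$ is the usual Banach space of scalar sequences indexed by $\mathbb{N}^*$. The bounded operator $B_{T,p}$ is $B_{T,p}((x_n))=(a_n)$ with $a_{6k}=x_{3k}$ for $k\ge1$, and $a_{6k+2}=x_{3k+1}$, $a_{6k+4}=a_{2k+1}=x_{3k+2}$ for $k\ge0$ (equivalently $a_n=x_{T(n)}$). The spectral radius of a bounded operator $A$ is $\rho(A)=\lim_{n\to\infty}\|A^n\|^{1/n}$. Convention: $1/\infty=0$. *)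

theory Defs
  imports "HOL-Analysis.Analysis"
begin

section \<open>The spaces \<open>\<ell>\<^sub>p\<close> over the positive integers\<close>

text \<open>
  Since \<open>p\<close> varies inside the statement, the spaces are carrier sets rather than types.
  The scalar type ranges over \<^class>\<open>real_normed_field\<close>, i.e. it is the reals or the
  complex numbers up to isometric isomorphism.  A sequence indexed by the positive integers is a
  function \<open>x\<close> on \<^typ>\<open>nat\<close>; the entry at the non-index \<open>0\<close> is fixed to be \<open>0\<close>,
  so that every sequence has a unique representative.  The exponent is an extended real, with
  \<open>1 \<le> p\<close> expressing \<open>p \<in> [1, \<infinity>]\<close>; note that \<open>1 / \<infinity> = 0\<close> in \<^typ>\<open>ereal\<close>.
\<close>

definition lp_space :: "ereal \<Rightarrow> (nat \<Rightarrow> 'a::real_normed_field) set" where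
  "lp_space p = {x. x 0 = 0 \<and>
     (if p = \<infinity> then bounded (x ` {1..})
      else (\<lambda>n. norm (x n) powr real_of_ereal p) summable_on {1..})}"

definition lp_norm :: "ereal \<Rightarrow> (nat \<Rightarrow> 'a::real_normed_field) \<Rightarrow> real" where
  "lp_norm p x =
     (if p = \<infinity> then (SUP n\<in>{1..}. norm (x n))
      else (\<Sum>\<^sub>\<infinity>n\<in>{1..}. norm (x n) powr real_of_ereal p) powr real_of_ereal (1 / p))"

definition lp_bounded_operator ::
    "ereal \<Rightarrow> ((nat \<Rightarrow> 'a::real_normed_field) \<Rightarrow> (nat \<Rightarrow> 'a)) \<Rightarrow> bool" where
  "lp_bounded_operator p A \<longleftrightarrow>
     (\<forall>x\<in>lp_space p. A x \<in> lp_space p) \<and>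
     (\<forall>x\<in>lp_space p. \<forall>y\<in>lp_space p. A (\<lambda>n. x n + y n) = (\<lambda>n. A x n + A y n)) \<and>
     (\<forall>c. \<forall>x\<in>lp_space p. A (\<lambda>n. c * x n) = (\<lambda>n. c * A x n)) \<and>
     (\<exists>C. \<forall>x\<in>lp_space p. lp_norm p (A x) \<le> C * lp_norm p x)"

definition lp_opnorm ::
    "ereal \<Rightarrow> ((nat \<Rightarrow> 'a::real_normed_field) \<Rightarrow> (nat \<Rightarrow> 'a)) \<Rightarrow> real" where
  "lp_opnorm p A = (SUP x\<in>{x \<in> lp_space p. lp_norm p x \<le> 1}. lp_norm p (A x))"

definition lp_spectral_radius ::
    "ereal \<Rightarrow> ((nat \<Rightarrow> 'a::real_normed_field) \<Rightarrow> (nat \<Rightarrow> 'a)) \<Rightarrow> real" where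
  "lp_spectral_radius p A = lim (\<lambda>n. root n (lp_opnorm p (A ^^ n)))"


section \<open>The Collatz map and its backward Koopman operator\<close>

definition collatz :: "nat \<Rightarrow> nat" where
  "collatz n = (if even n then n div 2 else (3 * n + 1) div 2)"

text \<open>
  The four defining cases are \<open>a\<^bsub>6k\<^esub> = x\<^bsub>3k\<^esub>\<close>, \<open>a\<^bsub>6k+2\<^esub> = x\<^bsub>3k+1\<^esub>\<close>,
  \<open>a\<^bsub>6k+4\<^esub> = x\<^bsub>3k+2\<^esub>\<close> and \<open>a\<^bsub>2k+1\<^esub> = x\<^bsub>3k+2\<^esub>\<close>.  For \<open>n = 0\<close> the first case
  copies the dummy entry.
\<close>

definition backward_collatz ::
    "(nat \<Rightarrow> 'a::real_normed_field) \<Rightarrow> (nat \<Rightarrow> 'a)" where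
  "backward_collatz x = (\<lambda>n.
     if n mod 6 = 0 then x (3 * (n div 6))
     else if n mod 6 = 2 then x (3 * (n div 6) + 1)
     else if n mod 6 = 4 then x (3 * (n div 6) + 2)
     else x (3 * (n div 2) + 2))"

lemma backward_collatz_eq: "backward_collatz x n = x (collatz n)"
proof -
  obtain k r where n: "n = 6 * k + r" "r < 6"
    by (metis mult_div_mod_eq mod_less_divisor zero_less_numeral)
  have e: "(6 * k + r) mod 6 = r" "(6 * k + r) div 6 = k" "even (6 * k + r) = even r"
    using n(2) by auto
  have d: "(6 * k + r) div 2 = 3 * k + r div 2"
    using div_mult_self2[of 2 r "3 * k"] by (simp add: algebra_simps)
  have o: "(3 * (6 * k + r) + 1) div 2 = 9 * k + (3 * r + 1) div 2"
    using div_mult_self2[of 2 "3 * r + 1" "9 * k"] by (simp add: algebra_simps)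
  have "r = 0 \<or> r = 1 \<or> r = 2 \<or> r = 3 \<or> r = 4 \<or> r = 5" using n(2) by linarith
  then show ?thesis
    unfolding n(1) backward_collatz_def collatz_def e d o
    by (elim disjE) (simp_all add: algebra_simps)
qed

lemma backward_collatz_cases:
  "backward_collatz x (6 * k) = x (3 * k)"
  "backward_collatz x (6 * k + 2) = x (3 * k + 1)"
  "backward_collatz x (6 * k + 4) = x (3 * k + 2)"
  "backward_collatz x (2 * k + 1) = x (3 * k + 2)"
  by (simp_all add: backward_collatz_eq collatz_def)


section \<open>The operator is bounded and the limit defining its spectral radius exists\<close>

lemma lp_summable_collatz:
  fixes f :: "nat \<Rightarrow> real"
  assumes "f summable_on {1..}" and nn: "\<And>n. f n \<ge> 0"
  shows "(\<lambda>n. f (collatz n)) summable_on {1..}"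
    and "(\<Sum>\<^sub>\<infinity>n\<in>{1..}. f (collatz n)) \<le> 2 * (\<Sum>\<^sub>\<infinity>n\<in>{1..}. f n)"
proof -
  let ?E = "(\<lambda>m::nat. 2 * m) ` {1..}" and ?O = "(\<lambda>k::nat. 2 * k + 1) ` UNIV"
  let ?R = "(\<lambda>k::nat. 3 * k + 2) ` UNIV"
  have split: "{1..} = ?E \<union> ?O"
  proof (intro equalityI subsetI)
    fix n :: nat assume n: "n \<in> {1..}"
    show "n \<in> ?E \<union> ?O"
    proof (cases "even n")
      case True then show ?thesis using n by (auto elim!: evenE)
    next
      case False then show ?thesis by (auto elim!: oddE)
    qed
  qed auto
  have disj: "?E \<inter> ?O = {}"
  proof -
    have "2 * m \<noteq> 2 * k + 1" for m k :: nat by (rule notI) (drule arg_cong[of _ _ even], simp)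
    then show ?thesis by blast
  qed
  have injE: "inj_on (\<lambda>m::nat. 2 * m) {1..}" and injO: "inj (\<lambda>k::nat. 2 * k + 1)"
    and injR: "inj (\<lambda>k::nat. 3 * k + 2)" by (auto simp: inj_on_def)
  have cE: "(\<lambda>n. f (collatz n)) \<circ> (\<lambda>m. 2 * m) = f"
    and cO: "(\<lambda>n. f (collatz n)) \<circ> (\<lambda>k. 2 * k + 1) = f \<circ> (\<lambda>k. 3 * k + 2)"
    by (auto simp: collatz_def fun_eq_iff)
  have R: "f summable_on ?R"
    by (rule summable_on_subset_banach[OF assms(1)]) auto
  have sE: "(\<lambda>n. f (collatz n)) summable_on ?E"
    using summable_on_reindex[OF injE, of "\<lambda>n. f (collatz n)"] assms(1) cE by simp
  have sO: "(\<lambda>n. f (collatz n)) summable_on ?O"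
    using summable_on_reindex[OF injO, of "\<lambda>n. f (collatz n)"]
      summable_on_reindex[OF injR, of f] R cO by simp
  have iE: "infsum (\<lambda>n. f (collatz n)) ?E = infsum f {1..}"
    using infsum_reindex[OF injE, of "\<lambda>n. f (collatz n)"] cE by simp
  have iO: "infsum (\<lambda>n. f (collatz n)) ?O = infsum f ?R"
    using infsum_reindex[OF injO, of "\<lambda>n. f (collatz n)"] infsum_reindex[OF injR, of f] cO by simp
  have "infsum (\<lambda>n. f (collatz n)) {1..}
      = infsum (\<lambda>n. f (collatz n)) ?E + infsum (\<lambda>n. f (collatz n)) ?O"
    using infsum_Un_disjoint[OF sE sO disj] by (simp only: split[symmetric])
  moreover have "infsum f ?R \<le> infsum f {1..}"
    by (rule infsum_mono_neutral[OF R assms(1)]) (auto simp: nn)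
  ultimately show "(\<Sum>\<^sub>\<infinity>n\<in>{1..}. f (collatz n)) \<le> 2 * (\<Sum>\<^sub>\<infinity>n\<in>{1..}. f n)"
    unfolding iE iO by linarith
  show "(\<lambda>n. f (collatz n)) summable_on {1..}"
    using summable_on_Un_disjoint[OF sE sO disj] by (simp only: split[symmetric])
qed

lemma lp_bdd_above: "x \<in> lp_space \<infinity> \<Longrightarrow> bdd_above ((\<lambda>n. norm (x n)) ` {1..})"
  unfolding lp_space_def by (auto simp: bounded_iff bdd_above_def)

lemma collatz_pos: "n \<ge> 1 \<Longrightarrow> collatz n \<ge> 1"
  unfolding collatz_def by (auto elim!: evenE)

lemma lp_norm_nonneg: "x \<in> lp_space p \<Longrightarrow> 0 \<le> lp_norm p x"
  using lp_bdd_above[of x] cSUP_upper[of "1::nat" "{1..}" "\<lambda>n. norm (x n)"]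
  by (cases "p = \<infinity>") (auto simp: lp_norm_def intro: order_trans[OF norm_ge_zero])

lemma backward_collatz_bounded:
  assumes p: "1 \<le> p"
  shows "lp_bounded_operator p (backward_collatz :: (nat \<Rightarrow> 'a::real_normed_field) \<Rightarrow> nat \<Rightarrow> 'a)"
proof -
  let ?B = "backward_collatz :: (nat \<Rightarrow> 'a) \<Rightarrow> nat \<Rightarrow> 'a"
  have B: "?B x = (\<lambda>n. x (collatz n))" for x by (simp add: backward_collatz_eq fun_eq_iff)
  have c0: "collatz 0 = 0" by (simp add: collatz_def)
  have "?B x \<in> lp_space p \<and> lp_norm p (?B x) \<le> 2 powr real_of_ereal (1 / p) * lp_norm p x"
    if x: "x \<in> lp_space p" for x
  proof (cases "p = \<infinity>")
    case True
    have "bounded (x ` {1..})" "x 0 = 0" using x True by (auto simp: lp_space_def)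
    moreover have "(\<lambda>n. x (collatz n)) ` {1..} \<subseteq> x ` {1..}" using collatz_pos by auto
    ultimately have "?B x \<in> lp_space p"
      unfolding B lp_space_def using True c0 by (auto intro: bounded_subset)
    moreover have "lp_norm p (?B x) \<le> lp_norm p x"
      unfolding B lp_norm_def using True lp_bdd_above[of x] x
      by (auto intro!: cSUP_least cSUP_upper collatz_pos[simplified])
    ultimately show ?thesis using True by simp
  next
    case False
    let ?r = "real_of_ereal p" and ?f = "\<lambda>n. norm (x n) powr real_of_ereal p"
    have s: "?f summable_on {1..}" "x 0 = 0" using x False by (auto simp: lp_space_def)
    note S = lp_summable_collatz[OF s(1)]
    have "0 \<le> infsum ?f {1..}" by (rule infsum_nonneg) auto
    moreover have "0 \<le> real_of_ereal (1 / p)"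
      using p False by (cases p) (auto simp: one_ereal_def)
    moreover have "0 \<le> (\<Sum>\<^sub>\<infinity>n\<in>{1..}. ?f (collatz n))" by (rule infsum_nonneg) auto
    ultimately have "(\<Sum>\<^sub>\<infinity>n\<in>{1..}. ?f (collatz n)) powr real_of_ereal (1 / p)
        \<le> 2 powr real_of_ereal (1 / p) * infsum ?f {1..} powr real_of_ereal (1 / p)"
      using S(2) by (subst powr_mult[symmetric]) (auto intro!: powr_mono2)
    then show ?thesis using False S(1) s(2) c0 by (auto simp: B lp_space_def lp_norm_def)
  qed
  then show ?thesis
    unfolding lp_bounded_operator_def by (auto simp: B)
qed

lemma lp_scale:
  fixes x :: "nat \<Rightarrow> 'a::real_normed_field"
  assumes p: "1 \<le> p" and x: "x \<in> lp_space p"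
  shows "(\<lambda>n. c * x n) \<in> lp_space p" "lp_norm p (\<lambda>n. c * x n) = norm c * lp_norm p x"
proof -
  have "(\<lambda>n. c * x n) \<in> lp_space p \<and> lp_norm p (\<lambda>n. c * x n) = norm c * lp_norm p x"
  proof (cases "p = \<infinity>")
    case True
    have b: "bounded (x ` {1..})" "x 0 = 0" using x True by (auto simp: lp_space_def)
    then obtain M where M: "\<And>n. n \<ge> 1 \<Longrightarrow> norm (x n) \<le> M" by (auto simp: bounded_iff)
    have "bounded ((\<lambda>n. c * x n) ` {1..})"
      unfolding bounded_iff using M
      by (auto simp: norm_mult intro!: exI[of _ "norm c * M"] mult_left_mono)
    moreover have "(SUP n\<in>{1..}. norm c * norm (x n)) = norm c * (SUP n\<in>{1..}. norm (x n))"
    proof -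
      have "continuous (at_left (SUP n\<in>{1..}. norm (x n))) (\<lambda>t. norm c * t)"
        by (intro continuous_intros)
      moreover have "mono (\<lambda>t. norm c * t)" by (intro monoI mult_left_mono) auto
      ultimately show ?thesis
        using continuous_at_Sup_mono[of "\<lambda>t. norm c * t" "(\<lambda>n. norm (x n)) ` {1..}"]
          lp_bdd_above[of x] x True by (simp add: image_image)
    qed
    ultimately show ?thesis using True b by (auto simp: lp_space_def lp_norm_def norm_mult)
  next
    case False
    obtain r where r: "p = ereal r" "r \<ge> 1" using p False by (cases p) auto
    have s: "(\<lambda>n. norm (x n) powr r) summable_on {1..}" "x 0 = 0"
      using x r by (auto simp: lp_space_def)
    have e: "(\<lambda>n. norm (c * x n) powr r) = (\<lambda>n. norm c powr r * norm (x n) powr r)"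
      by (auto simp: norm_mult powr_mult)
    have i: "0 \<le> (\<Sum>\<^sub>\<infinity>n\<in>{1..}. norm (x n) powr r)" by (rule infsum_nonneg) auto
    have q: "real_of_ereal (1 / p) = 1 / r" using r by (simp add: one_ereal_def)
    have "(norm c powr r) powr (1 / r) = norm c" using r by (simp add: powr_powr)
    then have "(\<Sum>\<^sub>\<infinity>n\<in>{1..}. norm (c * x n) powr r) powr (1 / r)
        = norm c * (\<Sum>\<^sub>\<infinity>n\<in>{1..}. norm (x n) powr r) powr (1 / r)"
      unfolding e using i by (simp add: infsum_cmult_right' powr_mult)
    moreover have "(\<lambda>n. norm (c * x n) powr r) summable_on {1..}"
      unfolding e by (rule summable_on_cmult_right[OF s(1)])
    ultimately show ?thesis using r s(2) q by (auto simp: lp_space_def lp_norm_def)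
  qed
  then show "(\<lambda>n. c * x n) \<in> lp_space p" "lp_norm p (\<lambda>n. c * x n) = norm c * lp_norm p x"
    by auto
qed

lemma lp_opnorm_bdd:
  assumes "lp_bounded_operator p A"
  shows "bdd_above ((\<lambda>x. lp_norm p (A x)) ` {x \<in> lp_space p. lp_norm p x \<le> 1})"
proof -
  obtain C where C: "\<And>x. x \<in> lp_space p \<Longrightarrow> lp_norm p (A x) \<le> C * lp_norm p x"
    using assms unfolding lp_bounded_operator_def by blast
  have "lp_norm p (A x) \<le> \<bar>C\<bar>" if "x \<in> lp_space p" "lp_norm p x \<le> 1" for x
  proof -
    have "C * lp_norm p x \<le> \<bar>C\<bar> * 1"
      using that lp_norm_nonneg[of x p] by (intro mult_mono) auto
    then show ?thesis using C[of x] that by simp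
  qed
  then show ?thesis by (intro bdd_aboveI2) auto
qed

lemma lp_opnorm_bound:
  fixes x :: "nat \<Rightarrow> 'a::real_normed_field"
  assumes p: "1 \<le> p" and A: "lp_bounded_operator p A" and x: "x \<in> lp_space p"
  shows "lp_norm p (A x) \<le> lp_opnorm p A * lp_norm p x"
proof (cases "lp_norm p x = 0")
  case True
  obtain C where C: "\<And>x. x \<in> lp_space p \<Longrightarrow> lp_norm p (A x) \<le> C * lp_norm p x"
    using A unfolding lp_bounded_operator_def by blast
  show ?thesis using C[OF x] True by simp
next
  case False
  let ?N = "lp_norm p x"
  have N: "?N > 0" using False lp_norm_nonneg[OF x] by simp
  let ?c = "of_real (1 / ?N) :: 'a"
  have c: "norm ?c = 1 / ?N" using N by (simp add: norm_divide)
  have Ax: "A x \<in> lp_space p" "A (\<lambda>n. ?c * x n) = (\<lambda>n. ?c * A x n)"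
    using A x unfolding lp_bounded_operator_def by blast+
  have u: "(\<lambda>n. ?c * x n) \<in> {x \<in> lp_space p. lp_norm p x \<le> 1}"
    using lp_scale[OF p x, of ?c] c N by simp
  have "lp_norm p (A (\<lambda>n. ?c * x n)) \<le> lp_opnorm p A"
    unfolding lp_opnorm_def by (rule cSUP_upper[OF u lp_opnorm_bdd[OF A]])
  then have "1 / ?N * lp_norm p (A x) \<le> lp_opnorm p A"
    using Ax(2) lp_scale(2)[OF p Ax(1), of ?c] c by simp
  then show ?thesis using N by (simp add: field_simps)
qed

lemma lp_bounded_operator_comp:
  fixes A B :: "(nat \<Rightarrow> 'a::real_normed_field) \<Rightarrow> nat \<Rightarrow> 'a"
  assumes p: "1 \<le> p" and A: "lp_bounded_operator p A" and B: "lp_bounded_operator p B"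
  shows "lp_bounded_operator p (A \<circ> B)" "lp_opnorm p (A \<circ> B) \<le> lp_opnorm p A * lp_opnorm p B"
proof -
  have z: "(\<lambda>n. 0) \<in> lp_space p" by (auto simp: lp_space_def bounded_iff)
  have z0: "lp_norm p (\<lambda>n. 0 :: 'a) = 0"
    using lp_scale(2)[OF p z, of 0] by simp
  have mA: "A x \<in> lp_space p" and mB: "B x \<in> lp_space p" if "x \<in> lp_space p" for x
    using A B that unfolding lp_bounded_operator_def by blast+
  have A0: "0 \<le> lp_opnorm p A"
  proof -
    have "lp_norm p (A (\<lambda>n. 0)) \<le> lp_opnorm p A"
      unfolding lp_opnorm_def using z z0 by (intro cSUP_upper lp_opnorm_bdd[OF A]) auto
    then show ?thesis using lp_norm_nonneg[OF mA[OF z]] by simp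
  qed
  have B0: "0 \<le> lp_opnorm p B"
  proof -
    have "lp_norm p (B (\<lambda>n. 0)) \<le> lp_opnorm p B"
      unfolding lp_opnorm_def using z z0 by (intro cSUP_upper lp_opnorm_bdd[OF B]) auto
    then show ?thesis using lp_norm_nonneg[OF mB[OF z]] by simp
  qed
  have bd: "lp_norm p (A (B x)) \<le> (lp_opnorm p A * lp_opnorm p B) * lp_norm p x"
    if "x \<in> lp_space p" for x
  proof -
    have "lp_norm p (A (B x)) \<le> lp_opnorm p A * lp_norm p (B x)"
      by (rule lp_opnorm_bound[OF p A mB[OF that]])
    also have "\<dots> \<le> lp_opnorm p A * (lp_opnorm p B * lp_norm p x)"
      by (rule mult_left_mono[OF lp_opnorm_bound[OF p B that] A0])
    finally show ?thesis by (simp add: mult.assoc)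
  qed
  show "lp_bounded_operator p (A \<circ> B)"
    unfolding lp_bounded_operator_def
  proof (intro conjI ballI allI)
    fix x y :: "nat \<Rightarrow> 'a" assume xy: "x \<in> lp_space p" "y \<in> lp_space p"
    have "B (\<lambda>n. x n + y n) = (\<lambda>n. B x n + B y n)"
      using B xy unfolding lp_bounded_operator_def by blast
    moreover have "A (\<lambda>n. B x n + B y n) = (\<lambda>n. A (B x) n + A (B y) n)"
      using A mB xy unfolding lp_bounded_operator_def by blast
    ultimately show "(A \<circ> B) (\<lambda>n. x n + y n) = (\<lambda>n. (A \<circ> B) x n + (A \<circ> B) y n)" by simp
  next
    fix c and x :: "nat \<Rightarrow> 'a" assume x: "x \<in> lp_space p"
    have "B (\<lambda>n. c * x n) = (\<lambda>n. c * B x n)"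
      using B x unfolding lp_bounded_operator_def by blast
    moreover have "A (\<lambda>n. c * B x n) = (\<lambda>n. c * A (B x) n)"
      using A mB x unfolding lp_bounded_operator_def by blast
    ultimately show "(A \<circ> B) (\<lambda>n. c * x n) = (\<lambda>n. c * (A \<circ> B) x n)" by simp
  qed (use bd mA mB in auto)
  show "lp_opnorm p (A \<circ> B) \<le> lp_opnorm p A * lp_opnorm p B"
    unfolding lp_opnorm_def[of p "A \<circ> B"]
  proof (rule cSUP_least)
    show "{x \<in> lp_space p. lp_norm p x \<le> 1} \<noteq> ({} :: (nat \<Rightarrow> 'a) set)" using z z0 by auto
    fix x :: "nat \<Rightarrow> 'a" assume x: "x \<in> {x \<in> lp_space p. lp_norm p x \<le> 1}"
    then have "lp_norm p (A (B x)) \<le> (lp_opnorm p A * lp_opnorm p B) * lp_norm p x"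
      using bd by simp
    also have "\<dots> \<le> (lp_opnorm p A * lp_opnorm p B) * 1"
      using x A0 B0 by (intro mult_left_mono) auto
    finally show "lp_norm p ((A \<circ> B) x) \<le> lp_opnorm p A * lp_opnorm p B" by simp
  qed
qed

lemma lp_bounded_operator_power:
  assumes p: "1 \<le> p" and A: "lp_bounded_operator p A"
  shows "lp_bounded_operator p (A ^^ n)"
proof (induction n)
  case 0
  show ?case by (auto simp: lp_bounded_operator_def intro: exI[of _ 1])
next
  case (Suc n)
  show ?case using lp_bounded_operator_comp(1)[OF p A Suc] by (simp add: comp_def)
qed

lemma subadditive_convergent:
  fixes b :: "nat \<Rightarrow> real"
  assumes sub: "\<And>m n. b (m + n) \<le> b m + b n" and nn: "\<And>n. 0 \<le> b n"
  shows "convergent (\<lambda>n. b n / real n)"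
proof -
  define L where "L = (INF n\<in>{1..}. b n / real n)"
  have lower: "L \<le> b n / real n" if "n \<ge> 1" for n
    unfolding L_def using that nn by (intro cINF_lower bdd_belowI2[of _ 0]) auto
  have "(\<lambda>n. b n / real n) \<longlonglongrightarrow> L"
  proof (rule LIMSEQ_I)
    fix e :: real assume e: "e > 0"
    obtain k where k: "k \<ge> 1" "b k / real k < L + e / 2"
    proof -
      have "\<exists>k\<in>{1..}. b k / real k < L + e / 2"
      proof (rule ccontr)
        assume "\<not> ?thesis"
        then have "L + e / 2 \<le> L"
          unfolding L_def by (intro cINF_greatest) (auto simp: not_less)
        then show False using e by simp
      qed
      then show ?thesis using that by auto
    qed
    define M where "M = (\<Sum>i<k. b i)"
    have mul: "b (q * k + r) \<le> real q * b k + b r" for q r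
    proof (induction q)
      case (Suc q)
      have "b (Suc q * k + r) \<le> b k + b (q * k + r)" using sub[of k "q * k + r"] by (simp add: add_ac)
      then show ?case using Suc by (simp add: algebra_simps)
    qed simp
    have up: "b n / real n \<le> b k / real k + M / real n" if n: "n \<ge> 1" for n
    proof -
      have "b (n mod k) \<le> M"
        unfolding M_def using k by (intro member_le_sum) (auto simp: nn)
      then have "b n \<le> real (n div k) * b k + M" using mul[of "n div k" "n mod k"] by simp
      also have "\<dots> \<le> real n / real k * b k + M"
        using nn by (intro add_right_mono mult_right_mono of_nat_div_le_of_nat) auto
      finally show ?thesis using n k by (simp add: field_simps)
    qed
    obtain N where N: "real N > 2 * M / e" using reals_Archimedean2 by blast
    have "norm (b n / real n - L) < e" if n: "n \<ge> max 1 N" for n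
    proof -
      have "2 * M / e < real n" using N n by linarith
      then have "M / real n < e / 2" using e n by (simp add: field_simps)
      moreover have "n \<ge> 1" using n by simp
      ultimately show ?thesis
        using up[of n] lower[of n] k(2) unfolding real_norm_def abs_less_iff by linarith
    qed
    then show "\<exists>no. \<forall>n\<ge>no. norm (b n / real n - L) < e" by blast
  qed
  then show ?thesis by (rule convergentI)
qed

lemma lp_opnorm_backward_collatz_ge_1:
  assumes p: "1 \<le> p"
  shows "1 \<le> lp_opnorm p ((backward_collatz :: (nat \<Rightarrow> 'a::real_normed_field) \<Rightarrow> nat \<Rightarrow> 'a) ^^ n)"
proof -
  let ?B = "backward_collatz :: (nat \<Rightarrow> 'a) \<Rightarrow> nat \<Rightarrow> 'a"
  have bd: "lp_bounded_operator p (?B ^^ n)"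
    by (rule lp_bounded_operator_power[OF p backward_collatz_bounded[OF p]])
  define x :: "nat \<Rightarrow> 'a" where "x = (\<lambda>n. if n = 1 \<or> n = 2 then 1 else 0)"
  have it: "(?B ^^ m) x j = x ((collatz ^^ m) j)" for m j
    by (induction m arbitrary: j) (simp_all add: backward_collatz_eq funpow_swap1[of collatz])
  have c: "(collatz ^^ m) j \<in> {1, 2}" if "j \<in> {1, 2}" for m j
    by (induction m) (use that in \<open>auto simp: collatz_def\<close>)
  have ge: "norm (x j) \<le> norm ((?B ^^ n) x j)" for j
    unfolding it using c[of j n] by (auto simp: x_def)
  have x: "x \<in> lp_space p"
  proof (cases "p = \<infinity>")
    case True then show ?thesis by (auto simp: lp_space_def x_def bounded_iff intro!: exI[of _ 1])
  next
    case False
    have "(\<lambda>n. norm (x n) powr real_of_ereal p) summable_on {1..}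
        \<longleftrightarrow> (\<lambda>n. norm (x n) powr real_of_ereal p) summable_on {1, 2}"
      by (rule summable_on_cong_neutral) (auto simp: x_def)
    then show ?thesis using False by (simp add: lp_space_def x_def)
  qed
  have Bx: "(?B ^^ n) x \<in> lp_space p" using bd x unfolding lp_bounded_operator_def by blast
  have le: "lp_norm p x \<le> lp_norm p ((?B ^^ n) x)" and pos: "0 < lp_norm p x"
  proof -
    have "lp_norm p x \<le> lp_norm p ((?B ^^ n) x) \<and> 0 < lp_norm p x"
    proof (cases "p = \<infinity>")
      case True
      have "norm (x 1) \<le> lp_norm p x"
        using True lp_bdd_above[of x] x unfolding lp_norm_def by (auto intro!: cSUP_upper)
      moreover have "lp_norm p x \<le> lp_norm p ((?B ^^ n) x)"
        using True lp_bdd_above[of "(?B ^^ n) x"] Bx ge unfolding lp_norm_def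
        by (auto intro!: cSUP_mono)
      ultimately show ?thesis by (simp add: x_def)
    next
      case False
      obtain r where r: "p = ereal r" "r \<ge> 1" using p False by (cases p) auto
      have s: "(\<lambda>n. norm (x n) powr r) summable_on {1..}"
        "(\<lambda>j. norm ((?B ^^ n) x j) powr r) summable_on {1..}"
        using x Bx r by (auto simp: lp_space_def)
      have 1: "infsum (\<lambda>n. norm (x n) powr r) {1..} \<le> infsum (\<lambda>j. norm ((?B ^^ n) x j) powr r) {1..}"
        using r ge by (intro infsum_mono[OF s] powr_mono2) auto
      have "infsum (\<lambda>n. norm (x n) powr r) {1..} = infsum (\<lambda>n. norm (x n) powr r) {1, 2}"
        by (rule infsum_cong_neutral) (auto simp: x_def)
      then have 2: "infsum (\<lambda>n. norm (x n) powr r) {1..} = 2" by (simp add: x_def)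
      have "real_of_ereal (1 / p) = 1 / r" using r by (simp add: one_ereal_def)
      then show ?thesis
        using 1 2 r unfolding lp_norm_def by (auto intro!: powr_mono2)
    qed
    then show "lp_norm p x \<le> lp_norm p ((?B ^^ n) x)" "0 < lp_norm p x" by auto
  qed
  have "1 * lp_norm p x \<le> lp_opnorm p (?B ^^ n) * lp_norm p x"
    using le lp_opnorm_bound[OF p bd x] by simp
  then show ?thesis using pos by (simp add: mult_le_cancel_right)
qed

lemma backward_collatz_spectral_radius_convergent:
  assumes p: "1 \<le> p"
  shows "convergent (\<lambda>n. root n (lp_opnorm p
           ((backward_collatz :: (nat \<Rightarrow> 'a::real_normed_field) \<Rightarrow> nat \<Rightarrow> 'a) ^^ n)))"
proof -
  let ?a = "\<lambda>n. lp_opnorm p ((backward_collatz :: (nat \<Rightarrow> 'a) \<Rightarrow> nat \<Rightarrow> 'a) ^^ n)"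
  have a1: "1 \<le> ?a n" for n by (rule lp_opnorm_backward_collatz_ge_1[OF p])
  have sub: "?a (m + n) \<le> ?a m * ?a n" for m n
    unfolding funpow_add
    by (intro lp_bounded_operator_comp p lp_bounded_operator_power backward_collatz_bounded)
  have "ln (?a (m + n)) \<le> ln (?a m) + ln (?a n)" for m n
  proof -
    have "0 < ?a m" "0 < ?a n" "0 < ?a (m + n)"
      using a1[of m] a1[of n] a1[of "m + n"] by linarith+
    then show ?thesis using sub[of m n] by (simp flip: ln_mult_pos)
  qed
  moreover have "0 \<le> ln (?a n)" for n using a1[of n] by simp
  ultimately obtain L where "(\<lambda>n. ln (?a n) / real n) \<longlonglongrightarrow> L"
    using subadditive_convergent[of "\<lambda>n. ln (?a n)"] unfolding convergent_def by blast
  then have "(\<lambda>n. exp (ln (?a n) / real n)) \<longlonglongrightarrow> exp L" by (rule tendsto_exp)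
  moreover have "eventually (\<lambda>n. exp (ln (?a n) / real n) = root n (?a n)) sequentially"
    using eventually_gt_at_top[of 0]
  proof eventually_elim
    case (elim n)
    have "0 < ?a n" using a1[of n] by linarith
    then show ?case using elim by (simp add: root_powr_inverse powr_def field_simps)
  qed
  ultimately have "(\<lambda>n. root n (?a n)) \<longlonglongrightarrow> exp L" by (rule Lim_transform_eventually)
  then show ?thesis by (rule convergentI)
qed

end

theory Submission
  imports Defs
begin

text \<open>
  The lower bound holds because \<open>{1, 2}\<close> is a cycle of the Collatz map \<open>T\<close>: its indicator sequence
  never decreases in norm under \<open>B\<close>, so every power of \<open>B\<close> has norm at least \<open>1\<close>.

  For the upper bound, if \<open>p = \<infinity>\<close>, then \<open>B\<^sup>n x\<close> takes only values of \<open>x\<close>, so \<open>\<parallel>B\<^sup>n\<parallel> \<le> 1\<close>.  If \<open>p\<close> is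
  finite, then \<open>\<parallel>B\<^sup>n x\<parallel>\<^sup>p\<close> is the sum of \<open>\<bar>x (T\<^sup>n j)\<bar>\<^sup>p\<close> over \<open>j\<close>, so the growth of
  \<open>\<parallel>B\<^sup>n\<parallel>\<^sup>p\<close> is governed by the size of the fibres of \<open>T\<^sup>n\<close>.  A number \<open>m\<close> always has the preimage
  \<open>2 m\<close>, and it has a second one, \<open>(2 m - 1) / 3\<close>, exactly if \<open>m\<close> is \<open>2\<close> modulo \<open>3\<close>.  In that case
  the preimage \<open>2 m\<close> is \<open>1\<close> modulo \<open>3\<close> and so does not branch again at once.  This is the Fibonacci
  growth pattern, hence the golden ratio \<open>\<phi>\<close>.

  No fibre has to be counted.  Give each branching number the weight \<open>\<phi>\<close> and every other number the
  weight \<open>1\<close>.  Since \<open>1 + \<phi> = \<phi>\<^sup>2\<close>, the preimages of \<open>m\<close> together weigh at most \<open>\<phi>\<close> times as much as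
  \<open>m\<close> (\<open>collatz_weight_preimages\<close>).  So in the norm of the correspondingly weighted \<open>\<ell>\<^sub>p\<close> space the
  operator has norm at most \<open>\<phi>\<^bsup>1/p\<^esup>\<close> (\<open>weighted_sum_collatz_le\<close>).  The weights lie between \<open>1\<close> and
  \<open>\<phi>\<close>, so passing between the weighted and the ordinary norm costs a single extra factor
  \<open>\<phi>\<^bsup>1/p\<^esup>\<close> in the bound on \<open>\<parallel>B\<^sup>n\<parallel>\<close> (\<open>lp_opnorm_backward_collatz_power_le\<close>), and this factor
  disappears under the \<open>n\<close>-th root.
\<close>

section \<open>Golden ratio weights on the Collatz preimage tree\<close>

definition golden_ratio :: real where
  "golden_ratio = (1 + sqrt 5) / 2"

lemma golden_ratio_gt_1: "golden_ratio > 1"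
  by (simp add: golden_ratio_def)

lemma golden_ratio_square: "golden_ratio * golden_ratio = 1 + golden_ratio"
  by (simp add: golden_ratio_def field_simps)

definition collatz_weight :: "nat \<Rightarrow> real" where
  "collatz_weight m = (if m mod 3 = 2 then golden_ratio else 1)"

lemma collatz_weight_bounds: "1 \<le> collatz_weight m" "collatz_weight m \<le> golden_ratio"
  using golden_ratio_gt_1 by (auto simp: collatz_weight_def)

text \<open>
  On the left, the second summand bounds the weight of the odd preimage of \<open>m\<close>, which exists only
  if \<open>m\<close> is \<open>2\<close> modulo \<open>3\<close> and whose own residue modulo \<open>3\<close> is arbitrary.
\<close>

lemma collatz_weight_preimages:
  "collatz_weight (2 * m) + (if m mod 3 = 2 then golden_ratio else 0)
     \<le> golden_ratio * collatz_weight m"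
proof -
  have "2 * m mod 3 = 2 * (m mod 3) mod 3"
    by (simp add: mod_mult_right_eq)
  moreover consider "m mod 3 = 0" | "m mod 3 = 1" | "m mod 3 = 2"
    by linarith
  ultimately show ?thesis
    using golden_ratio_gt_1 golden_ratio_square
    by cases (auto simp: collatz_weight_def)
qed

lemma collatz_weight_summable:
  assumes "f summable_on A" and "\<And>n. f n \<ge> 0"
  shows "(\<lambda>n. collatz_weight (g n) * f n) summable_on A"
proof (rule summable_on_comparison_test)
  show "(\<lambda>n. golden_ratio * f n) summable_on A"
    by (rule summable_on_cmult_right[OF assms(1)])
  show "collatz_weight (g n) * f n \<le> golden_ratio * f n"
    "0 \<le> collatz_weight (g n) * f n" for n
    using collatz_weight_bounds[of "g n"] assms(2)[of n]
    by (auto intro!: mult_right_mono mult_nonneg_nonneg)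
qed

text \<open>
  Splitting the sum on the left into even and odd \<open>n\<close> amounts to grouping the terms by the value
  \<open>m = T n\<close>: the even numbers \<open>n = 2 m\<close> reach every \<open>m\<close> once, the odd numbers \<open>n = 2 k + 1\<close> reach
  every \<open>m = 3 k + 2\<close> once.
\<close>

lemma weighted_sum_collatz_le:
  fixes f :: "nat \<Rightarrow> real"
  assumes f: "f summable_on {1..}" and nn: "\<And>n. f n \<ge> 0"
  shows "(\<Sum>\<^sub>\<infinity>n\<in>{1..}. collatz_weight n * f (collatz n))
           \<le> golden_ratio * (\<Sum>\<^sub>\<infinity>n\<in>{1..}. collatz_weight n * f n)"
proof -
  let ?h = "\<lambda>n. collatz_weight n * f (collatz n)"
  let ?E = "(\<lambda>m::nat. 2 * m) ` {1..}" and ?O = "(\<lambda>k::nat. 2 * k + 1) ` UNIV"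
  let ?b = "\<lambda>m. if m mod 3 = 2 then golden_ratio * f m else 0"
  have split: "{1..} = ?E \<union> ?O"
  proof (intro equalityI subsetI)
    fix n :: nat assume n: "n \<in> {1..}"
    show "n \<in> ?E \<union> ?O"
      using n by (cases "even n") (auto elim!: evenE oddE)
  qed auto
  have disj: "?E \<inter> ?O = {}"
  proof -
    have "2 * m \<noteq> 2 * k + 1" for m k :: nat by presburger
    then show ?thesis by blast
  qed
  have injE: "inj_on (\<lambda>m::nat. 2 * m) {1..}" and injO: "inj (\<lambda>k::nat. 2 * k + 1)"
    and injR: "inj (\<lambda>k::nat. 3 * k + 2)"
    by (auto simp: inj_on_def)
  have residue: "(\<lambda>k::nat. 3 * k + 2) ` UNIV = {m. m mod 3 = 2}"
  proof (intro equalityI subsetI)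
    fix m :: nat assume "m \<in> {m. m mod 3 = 2}"
    then have "m = 3 * (m div 3) + 2"
      using mult_div_mod_eq[of 3 m] by simp
    then show "m \<in> (\<lambda>k::nat. 3 * k + 2) ` UNIV" by blast
  qed (auto, presburger)
  have h: "?h summable_on {1..}"
    by (rule collatz_weight_summable[OF lp_summable_collatz(1)[OF f nn] nn])
  have sE: "?h summable_on ?E" and sO: "?h summable_on ?O"
    by (rule summable_on_subset_banach[OF h]; use split in blast)+

  have even: "infsum ?h ?E = (\<Sum>\<^sub>\<infinity>m\<in>{1..}. collatz_weight (2 * m) * f m)"
    using infsum_reindex[OF injE, of ?h] by (simp add: comp_def collatz_def)
  have fR: "f summable_on {m. m mod 3 = 2}"
    by (rule summable_on_subset_banach[OF f]) (auto intro: Suc_leI gr0I)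
  have sb: "?b summable_on {1..}"
    by (rule summable_on_comparison_test[OF summable_on_cmult_right[OF f, of golden_ratio]])
       (use nn golden_ratio_gt_1 in auto)
  have odd: "infsum ?h ?O \<le> infsum ?b {1..}"
  proof -
    have "infsum ?h ?O = (\<Sum>\<^sub>\<infinity>k\<in>UNIV. collatz_weight (2 * k + 1) * f (3 * k + 2))"
      using infsum_reindex[OF injO, of ?h] by (simp add: comp_def collatz_def)
    also have "\<dots> \<le> (\<Sum>\<^sub>\<infinity>k\<in>UNIV. golden_ratio * f (3 * k + 2))"
    proof (rule infsum_mono)
      have "(\<lambda>k. f (3 * k + 2)) summable_on UNIV"
        using summable_on_reindex[OF injR, of f] fR unfolding residue by (simp add: comp_def)
      then show "(\<lambda>k. collatz_weight (2 * k + 1) * f (3 * k + 2)) summable_on UNIV"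
        "(\<lambda>k. golden_ratio * f (3 * k + 2)) summable_on UNIV"
        using collatz_weight_summable[of "\<lambda>k. f (3 * k + 2)" UNIV "\<lambda>k. 2 * k + 1"] nn
        by (auto intro: summable_on_cmult_right)
    qed (intro mult_right_mono collatz_weight_bounds nn)
    also have "\<dots> = (\<Sum>\<^sub>\<infinity>m\<in>{m. m mod 3 = 2}. golden_ratio * f m)"
      using infsum_reindex[OF injR, of "\<lambda>m. golden_ratio * f m"]
      unfolding residue by (simp add: comp_def)
    also have "\<dots> = infsum ?b {1..}"
      by (rule infsum_cong_neutral) (auto intro: Suc_leI gr0I)
    finally show ?thesis .
  qed

  have s2: "(\<lambda>m. collatz_weight (2 * m) * f m) summable_on {1..}"
    by (rule collatz_weight_summable[OF f nn])
  have "infsum ?h {1..} = infsum ?h ?E + infsum ?h ?O"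
    using infsum_Un_disjoint[OF sE sO disj] by (simp only: split[symmetric])
  also have "\<dots> \<le> (\<Sum>\<^sub>\<infinity>m\<in>{1..}. collatz_weight (2 * m) * f m) + infsum ?b {1..}"
    using even odd by simp
  also have "\<dots> = (\<Sum>\<^sub>\<infinity>m\<in>{1..}. collatz_weight (2 * m) * f m + ?b m)"
    by (rule infsum_add[OF s2 sb, symmetric])
  also have "\<dots> \<le> (\<Sum>\<^sub>\<infinity>m\<in>{1..}. golden_ratio * (collatz_weight m * f m))"
  proof (rule infsum_mono)
    show "(\<lambda>m. collatz_weight (2 * m) * f m + ?b m) summable_on {1..}"
      by (rule summable_on_add[OF s2 sb])
    show "(\<lambda>m. golden_ratio * (collatz_weight m * f m)) summable_on {1..}"
      by (intro summable_on_cmult_right collatz_weight_summable f nn)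
    show "collatz_weight (2 * m) * f m + ?b m \<le> golden_ratio * (collatz_weight m * f m)" for m
      using mult_right_mono[OF collatz_weight_preimages[of m] nn[of m]]
      by (auto simp: algebra_simps split: if_splits)
  qed
  also have "\<dots> = golden_ratio * (\<Sum>\<^sub>\<infinity>m\<in>{1..}. collatz_weight m * f m)"
    by (rule infsum_cmult_right')
  finally show ?thesis .
qed

lemma summable_collatz_power:
  fixes f :: "nat \<Rightarrow> real"
  assumes "f summable_on {1..}" and "\<And>n. f n \<ge> 0"
  shows "(\<lambda>j. f ((collatz ^^ n) j)) summable_on {1..}"
  using assms
proof (induction n)
  case (Suc n)
  then show ?case
    using lp_summable_collatz(1)[of "\<lambda>j. f ((collatz ^^ n) j)"] by (simp add: funpow_swap1)
qed simp

lemma weighted_sum_collatz_power_le: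
  fixes f :: "nat \<Rightarrow> real"
  assumes f: "f summable_on {1..}" and nn: "\<And>n. f n \<ge> 0"
  shows "(\<Sum>\<^sub>\<infinity>j\<in>{1..}. collatz_weight j * f ((collatz ^^ n) j))
           \<le> golden_ratio ^ n * (\<Sum>\<^sub>\<infinity>j\<in>{1..}. collatz_weight j * f j)"
proof (induction n)
  case (Suc n)
  have "(\<Sum>\<^sub>\<infinity>j\<in>{1..}. collatz_weight j * f ((collatz ^^ Suc n) j))
      \<le> golden_ratio * (\<Sum>\<^sub>\<infinity>j\<in>{1..}. collatz_weight j * f ((collatz ^^ n) j))"
    using weighted_sum_collatz_le[OF summable_collatz_power[OF f nn] nn, of n]
    by (simp add: funpow_swap1)
  also have "\<dots> \<le> golden_ratio * (golden_ratio ^ n * (\<Sum>\<^sub>\<infinity>j\<in>{1..}. collatz_weight j * f j))"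
    using Suc.IH golden_ratio_gt_1 by (intro mult_left_mono) auto
  finally show ?case by (simp add: mult.assoc)
qed simp

text \<open>
  The exponent is \<open>n + 1\<close> rather than \<open>n\<close> because the weights, bounded below by \<open>1\<close> and above by
  \<open>\<phi>\<close>, are inserted on the left and removed on the right.
\<close>

lemma sum_collatz_power_le:
  fixes f :: "nat \<Rightarrow> real"
  assumes f: "f summable_on {1..}" and nn: "\<And>n. f n \<ge> 0"
  shows "(\<Sum>\<^sub>\<infinity>j\<in>{1..}. f ((collatz ^^ n) j)) \<le> golden_ratio ^ Suc n * (\<Sum>\<^sub>\<infinity>j\<in>{1..}. f j)"
proof -
  note s = summable_collatz_power[OF f nn, of n]
  have "(\<Sum>\<^sub>\<infinity>j\<in>{1..}. f ((collatz ^^ n) j))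
      \<le> (\<Sum>\<^sub>\<infinity>j\<in>{1..}. collatz_weight j * f ((collatz ^^ n) j))"
  proof (rule infsum_mono[OF s collatz_weight_summable[OF s nn]])
    show "f ((collatz ^^ n) j) \<le> collatz_weight j * f ((collatz ^^ n) j)" for j
      using mult_right_mono[OF collatz_weight_bounds(1)[of j] nn[of "(collatz ^^ n) j"]] by simp
  qed
  also have "\<dots> \<le> golden_ratio ^ n * (\<Sum>\<^sub>\<infinity>j\<in>{1..}. collatz_weight j * f j)"
    by (rule weighted_sum_collatz_power_le[OF f nn])
  also have "(\<Sum>\<^sub>\<infinity>j\<in>{1..}. collatz_weight j * f j) \<le> (\<Sum>\<^sub>\<infinity>j\<in>{1..}. golden_ratio * f j)"
    by (rule infsum_mono[OF collatz_weight_summable[OF f nn] summable_on_cmult_right[OF f]])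
       (intro mult_right_mono collatz_weight_bounds nn)
  also have "\<dots> = golden_ratio * (\<Sum>\<^sub>\<infinity>j\<in>{1..}. f j)"
    by (rule infsum_cmult_right')
  finally show ?thesis
    using golden_ratio_gt_1 by (simp add: mult_ac)
qed

section \<open>Norms of the powers of the operator\<close>

lemma backward_collatz_power: "(backward_collatz ^^ n) x = (\<lambda>j. x ((collatz ^^ n) j))"
  by (induction n) (simp_all add: backward_collatz_eq fun_eq_iff funpow_swap1)

lemma collatz_power_pos: "j \<ge> 1 \<Longrightarrow> (collatz ^^ n) j \<ge> 1"
  by (induction n) (simp_all add: collatz_pos[simplified])

lemma lp_norm_backward_collatz_power_le:
  fixes x :: "nat \<Rightarrow> 'a::real_normed_field"
  assumes p: "1 \<le> p" and x: "x \<in> lp_space p"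
  shows "lp_norm p ((backward_collatz ^^ n) x)
           \<le> golden_ratio powr (real (Suc n) * real_of_ereal (1 / p)) * lp_norm p x"
proof (cases "p = \<infinity>")
  case True
  have "lp_norm p ((backward_collatz ^^ n) x) \<le> lp_norm p x"
    unfolding backward_collatz_power lp_norm_def using True lp_bdd_above[of x] x
    by (auto intro!: cSUP_least cSUP_upper collatz_power_pos[simplified])
  then show ?thesis
    using True golden_ratio_gt_1 by simp
next
  case False
  let ?q = "real_of_ereal (1 / p)"
  let ?f = "\<lambda>j. norm (x j) powr real_of_ereal p"
  have s: "?f summable_on {1..}"
    using x False by (simp add: lp_space_def)
  have q: "0 \<le> ?q"
    using p False by (cases p) (auto simp: one_ereal_def)
  have "(\<Sum>\<^sub>\<infinity>j\<in>{1..}. ?f ((collatz ^^ n) j)) powr ?q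
      \<le> (golden_ratio ^ Suc n * (\<Sum>\<^sub>\<infinity>j\<in>{1..}. ?f j)) powr ?q"
    by (rule powr_mono2[OF q infsum_nonneg sum_collatz_power_le[OF s]]) auto
  also have "\<dots> = (golden_ratio ^ Suc n) powr ?q * (\<Sum>\<^sub>\<infinity>j\<in>{1..}. ?f j) powr ?q"
    by (rule powr_mult)
  also have "(golden_ratio ^ Suc n) powr ?q = golden_ratio powr (real (Suc n) * ?q)"
    using golden_ratio_gt_1 by (subst powr_realpow[symmetric]) (simp_all add: powr_powr)
  finally show ?thesis
    using False by (simp add: backward_collatz_power lp_norm_def)
qed

lemma lp_opnorm_le:
  fixes A :: "(nat \<Rightarrow> 'a::real_normed_field) \<Rightarrow> nat \<Rightarrow> 'a"
  assumes p: "1 \<le> p" and C: "0 \<le> C"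
    and bound: "\<And>x. x \<in> lp_space p \<Longrightarrow> lp_norm p (A x) \<le> C * lp_norm p x"
  shows "lp_opnorm p A \<le> C"
  unfolding lp_opnorm_def
proof (rule cSUP_least)
  have z: "(\<lambda>n. 0 :: 'a) \<in> lp_space p"
    by (auto simp: lp_space_def bounded_iff)
  then have "lp_norm p (\<lambda>n. 0 :: 'a) = 0"
    using lp_scale(2)[OF p z, of 0] by simp
  with z show "{x \<in> lp_space p. lp_norm p x \<le> 1} \<noteq> ({} :: (nat \<Rightarrow> 'a) set)"
    by auto
  fix x :: "nat \<Rightarrow> 'a" assume x: "x \<in> {x \<in> lp_space p. lp_norm p x \<le> 1}"
  then have "lp_norm p (A x) \<le> C * lp_norm p x"
    using bound by simp
  also have "\<dots> \<le> C * 1"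
    using x C by (intro mult_left_mono) auto
  finally show "lp_norm p (A x) \<le> C" by simp
qed

lemma lp_opnorm_backward_collatz_power_le:
  assumes p: "1 \<le> p"
  shows "lp_opnorm p ((backward_collatz :: (nat \<Rightarrow> 'a::real_normed_field) \<Rightarrow> nat \<Rightarrow> 'a) ^^ n)
           \<le> golden_ratio powr (real (Suc n) * real_of_ereal (1 / p))"
  by (rule lp_opnorm_le[OF p _ lp_norm_backward_collatz_power_le[OF p]]) simp

section \<open>The spectral radius\<close>

lemma root_powr_Suc_tendsto:
  fixes a q :: real
  assumes "a > 0"
  shows "(\<lambda>n. root n (a powr (real (Suc n) * q))) \<longlonglongrightarrow> a powr q"
proof -
  have "(\<lambda>n. a powr (q + q * inverse (real n))) \<longlonglongrightarrow> a powr (q + q * 0)"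
    using assms by (intro tendsto_intros lim_inverse_n) auto
  moreover have "eventually (\<lambda>n. a powr (q + q * inverse (real n))
      = root n (a powr (real (Suc n) * q))) sequentially"
    using eventually_gt_at_top[of 0]
  proof eventually_elim
    case (elim n)
    then show ?case
      using assms by (simp add: root_powr_inverse powr_powr field_simps)
  qed
  ultimately show ?thesis
    by (simp add: Lim_transform_eventually)
qed

lemma lp_spectral_radius_backward_collatz_bounds:
  fixes p :: ereal
  defines "\<rho> \<equiv> lp_spectral_radius p (backward_collatz :: (nat \<Rightarrow> 'a::real_normed_field) \<Rightarrow> nat \<Rightarrow> 'a)"
  assumes p: "1 \<le> p"
  shows "1 \<le> \<rho>" and "\<rho> \<le> golden_ratio powr real_of_ereal (1 / p)"
proof -
  let ?a = "\<lambda>n. lp_opnorm p ((backward_collatz :: (nat \<Rightarrow> 'a) \<Rightarrow> nat \<Rightarrow> 'a) ^^ n)"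
  have lim: "(\<lambda>n. root n (?a n)) \<longlonglongrightarrow> \<rho>"
    unfolding \<rho>_def lp_spectral_radius_def
    using backward_collatz_spectral_radius_convergent[OF p] by (simp add: convergent_LIMSEQ_iff)
  show "1 \<le> \<rho>"
  proof (rule LIMSEQ_le_const[OF lim], intro exI[of _ 1] allI impI)
    show "1 \<le> root n (?a n)" if "1 \<le> n" for n
      using that lp_opnorm_backward_collatz_ge_1[OF p] by (simp add: real_root_ge_1_iff)
  qed
  have "(\<lambda>n. root n (golden_ratio powr (real (Suc n) * real_of_ereal (1 / p))))
      \<longlonglongrightarrow> golden_ratio powr real_of_ereal (1 / p)"
    using golden_ratio_gt_1 by (intro root_powr_Suc_tendsto) auto
  then show "\<rho> \<le> golden_ratio powr real_of_ereal (1 / p)"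
  proof (rule LIMSEQ_le[OF lim], intro exI[of _ 1] allI impI)
    show "root n (?a n) \<le> root n (golden_ratio powr (real (Suc n) * real_of_ereal (1 / p)))"
      if "1 \<le> n" for n
      using that lp_opnorm_backward_collatz_power_le[OF p] by (intro real_root_le_mono) auto
  qed
qed

theorem corollary5p7:
  shows "(\<forall>p::ereal. 1 \<le> p \<longrightarrow>
            1 \<le> lp_spectral_radius p
              (backward_collatz :: (nat \<Rightarrow> 'a::real_normed_field) \<Rightarrow> nat \<Rightarrow> 'a) \<and>
            lp_spectral_radius p
              (backward_collatz :: (nat \<Rightarrow> 'a) \<Rightarrow> nat \<Rightarrow> 'a)
                \<le> ((1 + sqrt 5) / 2) powr real_of_ereal (1 / p)) \<and>
         lp_spectral_radius \<infinity>
           (backward_collatz :: (nat \<Rightarrow> 'a) \<Rightarrow> nat \<Rightarrow> 'a) = 1"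
proof -
  let ?\<rho> = "\<lambda>p. lp_spectral_radius p (backward_collatz :: (nat \<Rightarrow> 'a) \<Rightarrow> nat \<Rightarrow> 'a)"
  have bounds: "1 \<le> ?\<rho> p \<and> ?\<rho> p \<le> ((1 + sqrt 5) / 2) powr real_of_ereal (1 / p)"
    if "1 \<le> p" for p
    using lp_spectral_radius_backward_collatz_bounds[OF that] unfolding golden_ratio_def by blast
  have "?\<rho> \<infinity> \<le> 1"
  proof -
    have "0 < 1 + sqrt 5" by (simp add: add_pos_nonneg)
    then show ?thesis using bounds[of \<infinity>] by simp
  qed
  then show ?thesis
    using bounds bounds[of \<infinity>] by (intro conjI allI impI antisym) auto
qed

end
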